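(* There exists an online decide-on-arrival scheduler for the serial-parallel scheduling problem that is $3$-competitive for awake time: for every task arrival process $\mathcal{T}$, the awake time of the scheduler on $\mathcal{T}$ is at most $3$ times the awake time of the optimal offline schedule $\texttt{OPT}$ on $\mathcal{T}$.
   Context: Serial-parallel scheduling problem: there are $p$ identical processors ($p$ at least a sufficiently large constant). A task arrival process (TAP) is a finite set of tasks $\tau_1,\dots,\tau_n$; task $\tau_i$ is a triple $(\sigma_i,\pi_i,t_i)$ with arrival time $t_i\ge 0$ ($t_1\le\dots\le t_n$), serial work $\sigma_i$ and parallel work $\pi_i$, where $1\le \pi_i/\sigma_i\le p$. Each task can be performed either by its serial job (work $\sigma_i$, may run on at most one processor at any instant) or by its parallel job (work $\pi_i$, may run on any number of processors simultaneously, progressing at a rate equal to the number of processors). Time is continuous; at each instant the scheduler allocates the $p$ processors (fractionally, via time sharing) among arrived, unfinished jobs; a job completes when the integral over time of the processors allocated to it reaches its work. Before any work is done on a task the scheduler must irrevocably choose which of its two jobs to run; preemption (pausing and later resuming, possibly on other processors) is allowed. A task is alive from its arrival until its completion. The awake time of a schedule is the total measure of the set of times at which at least one task is alive. An online scheduler learns about task $\tau_i$ (its $\sigma_i,\pi_i,t_i$) only at time $t_i$ and does not know $n$ in advance; $\texttt{OPT}$ denotes an optimal offline schedule that knows the whole TAP in advance. A decide-on-arrival scheduler must, at the moment each task arrives, immediately and irrevocably decide whether to run its serial or parallel job. *)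

theory Defs
  imports "HOL-Analysis.Analysis"
begin

datatype task = Task (ser: real) (par: real) (arr: real)

text \<open>A schedule for a TAP given as a list of tasks (indices 0..n-1):
  job choice per task (True = parallel job, False = serial job) and a
  (fractional) processor allocation per task as a function of time.\<close>
record sched =
  choice :: "nat \<Rightarrow> bool"
  alloc  :: "nat \<Rightarrow> real \<Rightarrow> real"

definition valid_task :: "nat \<Rightarrow> task \<Rightarrow> bool" where
  "valid_task p x \<longleftrightarrow> ser x > 0 \<and> 1 \<le> par x / ser x \<and> par x / ser x \<le> real p \<and> arr x \<ge> 0"

definition valid_TAP :: "nat \<Rightarrow> task list \<Rightarrow> bool" where
  "valid_TAP p T \<longleftrightarrow> (\<forall>x\<in>set T. valid_task p x) \<and> sorted (map arr T)"

definition work :: "task list \<Rightarrow> sched \<Rightarrow> nat \<Rightarrow> real" where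
  "work T S i = (if choice S i then par (T ! i) else ser (T ! i))"

definition processed :: "task list \<Rightarrow> sched \<Rightarrow> nat \<Rightarrow> real \<Rightarrow> real" where
  "processed T S i c = (LINT s:{arr (T ! i)..c}|lborel. alloc S i s)"

definition valid_sched :: "nat \<Rightarrow> task list \<Rightarrow> sched \<Rightarrow> bool" where
  "valid_sched p T S \<longleftrightarrow>
     (\<forall>i < length T.
        alloc S i \<in> borel_measurable lborel \<and>
        (\<forall>s. 0 \<le> alloc S i s) \<and>
        (\<forall>s. s < arr (T ! i) \<longrightarrow> alloc S i s = 0) \<and>
        (\<not> choice S i \<longrightarrow> (\<forall>s. alloc S i s \<le> 1)) \<and>
        (\<exists>c \<ge> arr (T ! i). work T S i \<le> processed T S i c)) \<and>
     (\<forall>s. (\<Sum>i<length T. alloc S i s) \<le> real p)"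

definition completion :: "task list \<Rightarrow> sched \<Rightarrow> nat \<Rightarrow> real" where
  "completion T S i = Inf {c. arr (T ! i) \<le> c \<and> work T S i \<le> processed T S i c}"

definition awake :: "task list \<Rightarrow> sched \<Rightarrow> real" where
  "awake T S = measure lborel (\<Union>i<length T. {arr (T ! i)..<completion T S i})"

definition OPT :: "nat \<Rightarrow> task list \<Rightarrow> real" where
  "OPT p T = Inf (awake T ` {S. valid_sched p T S})"

text \<open>Tasks that have arrived by time t (a prefix of the sorted TAP).\<close>
definition arrived_by :: "task list \<Rightarrow> real \<Rightarrow> task list" where
  "arrived_by T t = takeWhile (\<lambda>x. arr x \<le> t) T"

definition online :: "nat \<Rightarrow> (task list \<Rightarrow> sched) \<Rightarrow> bool" where
  "online p A \<longleftrightarrow>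
     (\<forall>T T' t. valid_TAP p T \<longrightarrow> valid_TAP p T' \<longrightarrow> arrived_by T t = arrived_by T' t \<longrightarrow>
        (\<forall>i < length (arrived_by T t). \<forall>s \<le> t. alloc (A T) i s = alloc (A T') i s))"

definition decide_on_arrival :: "nat \<Rightarrow> (task list \<Rightarrow> sched) \<Rightarrow> bool" where
  "decide_on_arrival p A \<longleftrightarrow>
     (\<forall>T T' i. valid_TAP p T \<longrightarrow> valid_TAP p T' \<longrightarrow> i < length T \<longrightarrow>
        arrived_by T (arr (T ! i)) = arrived_by T' (arr (T ! i)) \<longrightarrow>
        choice (A T) i = choice (A T') i)"

end

theory Submission
  imports Defs
begin

text \<open>
  The scheduler keeps all \<open>p\<close> processors busy whenever a task is alive, so its awake time is the
  total work it chose, divided by \<open>p\<close>. It shares the processors in proportion to the remaining work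
  of the alive jobs, so that all of them are planned to end at one common time. A serial job then
  stays within rate 1 if its work is at most the time left to the common end of the earlier jobs,
  and the task is run serially exactly in this case.

  Compare with any schedule \<open>S\<close> up to a time \<open>b\<close>. If \<open>S\<close> has an unfinished task at time \<open>b\<close>, then
  \<open>S\<close> has been awake since its arrival, and one goes back to that arrival. Otherwise take the last task
  \<open>i\<close> that the scheduler ran in parallel and \<open>S\<close> serially, and let \<open>\<sigma>\<close> be its serial work.
  At its arrival the remaining work was less than \<open>p \<sigma>\<close>, its parallel work is at most \<open>p \<sigma>\<close>, and the
  later tasks cost the scheduler at most what they cost \<open>S\<close>. Since \<open>S\<close> is awake for at least \<open>\<sigma>\<close>
  after the arrival of \<open>i\<close>, each of the three terms is paid for by the awake time of \<open>S\<close> after that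
  arrival.
\<close>

section \<open>Valid schedules\<close>

definition awake_set :: "task list \<Rightarrow> sched \<Rightarrow> real set" where
  "awake_set T S = (\<Union>i<length T. {arr (T ! i)..<completion T S i})"

definition awake_within :: "task list \<Rightarrow> sched \<Rightarrow> real \<Rightarrow> real \<Rightarrow> real" where
  "awake_within T S a b = measure lborel (awake_set T S \<inter> {a..<b})"

lemma fmeasurable_Icc [simp]: "{a..b::real} \<in> fmeasurable lborel"
  using fmeasurable_cbox[of a b] by simp

lemma fmeasurable_Ico [simp]: "{a..<b::real} \<in> fmeasurable lborel"
  by (rule fmeasurableI2[OF fmeasurable_Icc[of a b]]) auto

lemma fmeasurable_Ioc [simp]: "{a<..b::real} \<in> fmeasurable lborel"
  by (rule fmeasurableI2[OF fmeasurable_Icc[of a b]]) auto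

lemma awake_set_borel [simp, measurable]: "awake_set T S \<in> sets borel"
  by (simp add: awake_set_def)

lemma fmeasurable_awake_set [simp]: "awake_set T S \<in> fmeasurable lborel"
  unfolding awake_set_def by (intro fmeasurable.finite_UN) auto

lemma fmeasurable_awake_set_Int_Ico [simp]: "awake_set T S \<inter> {a..<b} \<in> fmeasurable lborel"
  by (intro fmeasurable_Int_fmeasurable) auto

lemma awake_eq_measure_awake_set: "awake T S = measure lborel (awake_set T S)"
  by (simp add: awake_def awake_set_def)

lemma awake_within_nonneg: "0 \<le> awake_within T S a b"
  by (simp add: awake_within_def)

lemma awake_within_le_awake: "awake_within T S a b \<le> awake T S"
  unfolding awake_within_def awake_eq_measure_awake_set
  by (intro measure_mono_fmeasurable) auto

lemma awake_within_mono: "b \<le> c \<Longrightarrow> awake_within T S a b \<le> awake_within T S a c"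
  unfolding awake_within_def by (intro measure_mono_fmeasurable) auto

lemma awake_within_split:
  assumes "a \<le> b" "b \<le> c"
  shows "awake_within T S a c = awake_within T S a b + awake_within T S b c"
proof -
  have "awake_set T S \<inter> {a..<c} = awake_set T S \<inter> {a..<b} \<union> awake_set T S \<inter> {b..<c}"
    using assms by auto
  moreover have "(awake_set T S \<inter> {a..<b}) \<inter> (awake_set T S \<inter> {b..<c}) = {}" by auto
  ultimately show ?thesis
    unfolding awake_within_def by (simp only: measure_Un3 fmeasurable_awake_set_Int_Ico) simp
qed

lemma awake_within_alive:
  assumes "i < length T" "arr (T ! i) \<le> b" "b \<le> completion T S i"
  shows "awake_within T S (arr (T ! i)) b = b - arr (T ! i)"
proof -
  have "awake_set T S \<inter> {arr (T ! i)..<b} = {arr (T ! i)..<b}"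
    using assms by (force simp: awake_set_def)
  then show ?thesis using assms by (simp add: awake_within_def)
qed

lemma completion_le:
  assumes "arr (T ! i) \<le> c" "work T S i \<le> processed T S i c"
  shows "completion T S i \<le> c"
  unfolding completion_def using assms by (intro cInf_lower bdd_belowI[of _ "arr (T ! i)"]) auto

locale valid_schedule =
  fixes p :: nat and T :: "task list" and S :: sched
  assumes valid_sched: "valid_sched p T S"
begin

lemma
  assumes "i < length T"
  shows alloc_measurable: "alloc S i \<in> borel_measurable lborel"
    and alloc_nonneg: "0 \<le> alloc S i s"
    and serial_alloc_le_1: "\<not> choice S i \<Longrightarrow> alloc S i s \<le> 1"
  using valid_sched assms by (auto simp: valid_sched_def)

lemma sum_alloc_le:
  assumes "K \<subseteq> {..<length T}"
  shows "(\<Sum>k\<in>K. alloc S k s) \<le> real p"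
proof -
  have "(\<Sum>k\<in>K. alloc S k s) \<le> (\<Sum>k<length T. alloc S k s)"
    using assms by (intro sum_mono2) (auto simp: alloc_nonneg)
  also have "\<dots> \<le> real p" using valid_sched by (simp add: valid_sched_def)
  finally show ?thesis .
qed

lemma alloc_le: "i < length T \<Longrightarrow> alloc S i s \<le> real p"
  using sum_alloc_le[of "{i}"] by simp

lemma set_integrable_alloc:
  assumes "i < length T" "A \<in> fmeasurable lborel"
  shows "set_integrable lborel A (alloc S i)"
  unfolding set_integrable_def
proof (rule integrableI_bounded_set[where A = A and B = "real p"])
  show "AE x in lborel. x \<in> A \<longrightarrow> norm (indicator A x *\<^sub>R alloc S i x) \<le> real p"
    using assms by (auto simp: alloc_le alloc_nonneg)
qed (use assms alloc_measurable in \<open>auto simp: fmeasurable_def\<close>)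

lemma processed_diff_bounds:
  assumes i: "i < length T" and b: "\<And>s. alloc S i s \<le> b" and "arr (T ! i) \<le> c" "c \<le> d"
  shows "processed T S i d - processed T S i c \<in> {0..b * (d - c)}"
proof -
  have "{arr (T ! i)..d} = {arr (T ! i)..c} \<union> {c<..d}" using assms by auto
  then have "processed T S i d - processed T S i c = (LINT s:{c<..d}|lborel. alloc S i s)"
    unfolding processed_def using i
    by (simp only:) (subst set_integral_Un; auto intro: set_integrable_alloc)
  moreover have "0 \<le> (LINT s:{c<..d}|lborel. alloc S i s)"
    using i by (auto simp: set_lebesgue_integral_def alloc_nonneg)
  moreover have "(LINT s:{c<..d}|lborel. alloc S i s) \<le> (LINT s:{c<..d}|lborel. b)"
    using assms by (intro set_integral_mono set_integrable_alloc)
      (auto simp: set_integrable_def fmeasurable_def)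
  moreover have "\<dots> = b * (d - c)"
    using assms by (simp add: set_lebesgue_integral_def)
  ultimately show ?thesis by simp
qed

lemma lipschitz_on_processed:
  assumes "i < length T"
  shows "(real p)-lipschitz_on {arr (T ! i)..} (processed T S i)"
  using processed_diff_bounds[OF assms alloc_le[OF assms]]
  by (intro lipschitz_on_leI) (auto simp: dist_real_def)

lemma
  assumes "i < length T"
  shows arr_le_completion: "arr (T ! i) \<le> completion T S i"
    and work_le_processed_completion: "work T S i \<le> processed T S i (completion T S i)"
proof -
  let ?D = "{arr (T ! i)..} \<inter> processed T S i -` {work T S i..}"
  have "closed ?D"
    by (intro continuous_closed_preimage
        lipschitz_on_continuous_on[OF lipschitz_on_processed[OF assms]]) auto
  moreover have "\<exists>c. c \<in> ?D" using valid_sched assms by (auto simp: valid_sched_def)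
  then have "?D \<noteq> {}" by blast
  moreover have "bdd_below ?D" by (auto intro: bdd_belowI)
  ultimately have "Inf ?D \<in> ?D" by (intro closed_contains_Inf)
  moreover have "completion T S i = Inf ?D"
    unfolding completion_def by (intro arg_cong[where f = Inf]) auto
  ultimately show "arr (T ! i) \<le> completion T S i"
    "work T S i \<le> processed T S i (completion T S i)" by auto
qed

lemma processed_eq_Ico:
  assumes "i < length T"
  shows "processed T S i c = (LINT s:{arr (T ! i)..<c}|lborel. alloc S i s)"
  unfolding processed_def set_lebesgue_integral_def
  using alloc_measurable[OF assms] AE_lborel_singleton[of c]
  by (intro integral_cong_AE) (auto simp: indicator_def elim!: eventually_mono)

lemma ser_le_awake_within:
  assumes i: "i < length T" "\<not> choice S i" and b: "completion T S i \<le> b"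
  shows "ser (T ! i) \<le> awake_within T S (arr (T ! i)) b"
proof -
  have "processed T S i (arr (T ! i)) = 0"
    using i by (simp add: processed_eq_Ico set_lebesgue_integral_def)
  then have "ser (T ! i) \<le> completion T S i - arr (T ! i)"
    using i work_le_processed_completion[of i] arr_le_completion[of i]
      processed_diff_bounds[of i 1 "arr (T ! i)" "completion T S i"]
    by (simp add: work_def serial_alloc_le_1)
  also have "\<dots> = awake_within T S (arr (T ! i)) (completion T S i)"
    using i arr_le_completion by (intro awake_within_alive[symmetric]) auto
  also have "\<dots> \<le> awake_within T S (arr (T ! i)) b"
    using b by (rule awake_within_mono)
  finally show ?thesis .
qed

lemma work_le_set_integral_alloc:
  assumes "i < length T" "a \<le> arr (T ! i)" "completion T S i \<le> b"
  shows "work T S i \<le> (LINT s:awake_set T S \<inter> {a..<b}|lborel. alloc S i s)"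
proof -
  have "work T S i \<le> (LINT s:{arr (T ! i)..<completion T S i}|lborel. alloc S i s)"
    using assms work_le_processed_completion[of i] by (simp add: processed_eq_Ico)
  also have "\<dots> \<le> (LINT s:awake_set T S \<inter> {a..<b}|lborel. alloc S i s)"
    unfolding set_lebesgue_integral_def
  proof (rule integral_mono)
    show "indicator {arr (T ! i)..<completion T S i} s *\<^sub>R alloc S i s
        \<le> indicator (awake_set T S \<inter> {a..<b}) s *\<^sub>R alloc S i s" for s
      using assms alloc_nonneg[of i s] by (auto simp: awake_set_def indicator_def)
  qed (use assms in \<open>simp_all add: set_integrable_alloc flip: set_integrable_def del: real_scaleR_def\<close>)
  finally show ?thesis .
qed

lemma sum_work_le_awake_within:
  assumes K: "K \<subseteq> {..<length T}" "\<And>k. k \<in> K \<Longrightarrow> a \<le> arr (T ! k) \<and> completion T S k \<le> b"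
  shows "(\<Sum>k\<in>K. work T S k) \<le> real p * awake_within T S a b"
proof -
  let ?U = "awake_set T S \<inter> {a..<b}"
  have integrable: "set_integrable lborel ?U (alloc S k)" if "k \<in> K" for k
    using that K(1) by (auto intro: set_integrable_alloc)
  have "(\<Sum>k\<in>K. work T S k) \<le> (\<Sum>k\<in>K. LINT s:?U|lborel. alloc S k s)"
    using K by (intro sum_mono work_le_set_integral_alloc) auto
  also have "\<dots> = (LINT s:?U|lborel. \<Sum>k\<in>K. alloc S k s)"
    using integrable
    by (simp add: set_lebesgue_integral_def set_integrable_def scaleR_sum_right
        del: real_scaleR_def)
  also have "\<dots> \<le> (LINT s:?U|lborel. real p)"
  proof (rule set_integral_mono)
    show "set_integrable lborel ?U (\<lambda>s. \<Sum>k\<in>K. alloc S k s)"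
      using integrable by (simp add: set_integrable_def scaleR_sum_right del: real_scaleR_def)
    show "set_integrable lborel ?U (\<lambda>s. real p)"
      using fmeasurableD2[OF fmeasurable_awake_set_Int_Ico]
      by (auto simp: set_integrable_def less_top)
  qed (rule sum_alloc_le[OF K(1)])
  also have "\<dots> = real p * awake_within T S a b"
    by (simp add: set_lebesgue_integral_def awake_within_def)
  finally show ?thesis .
qed

end

section \<open>The scheduler\<close>

text \<open>\<open>finish p T k\<close> is the time at which the first \<open>k\<close> tasks are all done if no other task arrives.\<close>

fun finish :: "nat \<Rightarrow> task list \<Rightarrow> nat \<Rightarrow> real"
  and goes_parallel :: "nat \<Rightarrow> task list \<Rightarrow> nat \<Rightarrow> bool"
  and load :: "nat \<Rightarrow> task list \<Rightarrow> nat \<Rightarrow> real" where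
  "finish p T 0 = 0"
| "finish p T (Suc k) = max (finish p T k) (arr (T ! k)) + load p T k / real p"
| "goes_parallel p T k \<longleftrightarrow> finish p T k < arr (T ! k) + ser (T ! k)"
| "load p T k = (if goes_parallel p T k then par (T ! k) else ser (T ! k))"

declare goes_parallel.simps [simp del] load.simps [simp del]

text \<open>The backlog at time \<open>s\<close> is a duration: the remaining work divided by \<open>p\<close>.\<close>

definition backlog :: "nat \<Rightarrow> task list \<Rightarrow> nat \<Rightarrow> real \<Rightarrow> real" where
  "backlog p T k s = max 0 (finish p T k - s)"

text \<open>\<open>rate p T k i\<close> is the number of processors given to task \<open>i\<close> once exactly the first \<open>k\<close> tasks have
  arrived. An arrival scales all existing rates down by the same factor.\<close>

fun rate :: "nat \<Rightarrow> task list \<Rightarrow> nat \<Rightarrow> nat \<Rightarrow> real" where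
  "rate p T 0 i = 0"
| "rate p T (Suc k) i =
     (if i = k then load p T k else rate p T k i * backlog p T k (arr (T ! k)))
       / backlog p T (Suc k) (arr (T ! k))"

fun plan :: "nat \<Rightarrow> task list \<Rightarrow> nat \<Rightarrow> nat \<Rightarrow> real \<Rightarrow> real" where
  "plan p T 0 i s = 0"
| "plan p T (Suc k) i s =
     (if s < arr (T ! k) then plan p T k i s
      else if s < finish p T (Suc k) then rate p T (Suc k) i else 0)"

definition balanced_sched :: "nat \<Rightarrow> task list \<Rightarrow> sched" where
  "balanced_sched p T = \<lparr>choice = goes_parallel p T, alloc = plan p T (length T)\<rparr>"

lemma backlog_nonneg: "0 \<le> backlog p T k s"
  by (simp add: backlog_def)

lemma rate_eq_0: "k \<le> i \<Longrightarrow> rate p T k i = 0"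
  by (induction k) auto

lemma plan_eq_0: "k \<le> i \<Longrightarrow> plan p T k i s = 0"
  by (induction k) (auto simp: rate_eq_0 simp del: rate.simps)

lemma work_balanced_sched: "work T (balanced_sched p T) i = load p T i"
  by (simp add: work_def load.simps balanced_sched_def)

subsection \<open>Online behaviour\<close>

lemma
  assumes "\<And>j. j < k \<Longrightarrow> T ! j = T' ! j"
  shows finish_cong: "finish p T k = finish p T' k"
    and goes_parallel_cong: "T ! k = T' ! k \<Longrightarrow> goes_parallel p T k = goes_parallel p T' k"
    and load_cong: "T ! k = T' ! k \<Longrightarrow> load p T k = load p T' k"
proof -
  show "finish p T k = finish p T' k"
    using assms by (induction k) (auto simp: load.simps goes_parallel.simps)
  then show "goes_parallel p T k = goes_parallel p T' k" "load p T k = load p T' k"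
    if "T ! k = T' ! k"
    using that by (simp_all add: load.simps goes_parallel.simps)
qed

lemma rate_cong: "(\<And>j. j < k \<Longrightarrow> T ! j = T' ! j) \<Longrightarrow> rate p T k i = rate p T' k i"
proof (induction k)
  case (Suc k)
  then show ?case
    using finish_cong[of k T T' p] load_cong[of k T T' p] by (simp add: backlog_def)
qed simp

lemma plan_cong: "(\<And>j. j < k \<Longrightarrow> T ! j = T' ! j) \<Longrightarrow> plan p T k i s = plan p T' k i s"
proof (induction k)
  case (Suc k)
  then show ?case
    using finish_cong[of "Suc k" T T' p] rate_cong[of "Suc k" T T' p i]
    by (simp del: rate.simps finish.simps)
qed simp

lemma plan_eq_earlier:
  assumes "m \<le> k" "\<And>j. m \<le> j \<Longrightarrow> j < k \<Longrightarrow> s < arr (T ! j)"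
  shows "plan p T k i s = plan p T m i s"
  using assms by (induction k rule: dec_induct) auto

lemma length_arrived_by_le: "length (arrived_by T t) \<le> length T"
  by (simp add: arrived_by_def length_takeWhile_le)

lemma less_length_arrived_by_iff:
  assumes "sorted (map arr T)" "i < length T"
  shows "i < length (arrived_by T t) \<longleftrightarrow> arr (T ! i) \<le> t"
proof
  show "arr (T ! i) \<le> t" if "i < length (arrived_by T t)"
    using that unfolding arrived_by_def by (metis nth_mem set_takeWhileD takeWhile_nth)
next
  let ?m = "length (arrived_by T t)"
  show "i < ?m" if "arr (T ! i) \<le> t"
  proof (rule ccontr)
    assume "\<not> i < ?m"
    then have "arr (T ! ?m) \<le> arr (T ! i)"
      using assms sorted_nth_mono[of "map arr T" ?m i] by simp
    moreover have "\<not> arr (T ! ?m) \<le> t"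
      using \<open>\<not> i < ?m\<close> assms(2) nth_length_takeWhile[of "\<lambda>x. arr x \<le> t" T]
      by (simp add: arrived_by_def)
    ultimately show False using that by simp
  qed
qed

lemma arrived_by_eq_nth:
  assumes "arrived_by T t = arrived_by T' t" "j < length (arrived_by T t)"
  shows "T ! j = T' ! j"
  using assms unfolding arrived_by_def by (metis takeWhile_nth)

lemma plan_arrived_by:
  assumes "sorted (map arr T)" "s \<le> t"
  shows "plan p T (length T) i s = plan p T (length (arrived_by T t)) i s"
proof (rule plan_eq_earlier[OF length_arrived_by_le])
  show "s < arr (T ! j)" if "length (arrived_by T t) \<le> j" "j < length T" for j
    using that assms less_length_arrived_by_iff[of T j t] by simp
qed

lemma online_balanced_sched: "online p (balanced_sched p)"
  unfolding online_def
proof (intro allI impI)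
  fix T T' t i and s :: real
  assume valid: "valid_TAP p T" "valid_TAP p T'"
    and arrived: "arrived_by T t = arrived_by T' t" and "s \<le> t"
  then have "plan p T (length T) i s = plan p T (length (arrived_by T t)) i s"
    by (intro plan_arrived_by) (auto simp: valid_TAP_def)
  also have "\<dots> = plan p T' (length (arrived_by T t)) i s"
    using arrived by (intro plan_cong arrived_by_eq_nth)
  also have "\<dots> = plan p T' (length T') i s"
    using valid arrived \<open>s \<le> t\<close>
    by (simp add: plan_arrived_by[of T' s t] valid_TAP_def)
  finally show "alloc (balanced_sched p T) i s = alloc (balanced_sched p T') i s"
    by (simp add: balanced_sched_def)
qed

lemma decide_on_arrival_balanced_sched: "decide_on_arrival p (balanced_sched p)"
  unfolding decide_on_arrival_def
proof (intro allI impI)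
  fix T T' i
  assume valid: "valid_TAP p T" and i: "i < length T"
    and arrived: "arrived_by T (arr (T ! i)) = arrived_by T' (arr (T ! i))"
  have "i < length (arrived_by T (arr (T ! i)))"
    using valid i by (simp add: less_length_arrived_by_iff valid_TAP_def)
  then have "T ! j = T' ! j" if "j \<le> i" for j
    using that arrived by (intro arrived_by_eq_nth) auto
  then show "choice (balanced_sched p T) i = choice (balanced_sched p T') i"
    using goes_parallel_cong[of i T T' p] by (simp add: balanced_sched_def)
qed

subsection \<open>Validity and awake time\<close>

locale tap =
  fixes p :: nat and T :: "task list"
  assumes p_pos: "0 < p" and valid_TAP: "valid_TAP p T"
begin

lemma sorted_arr: "sorted (map arr T)"
  using valid_TAP by (simp add: valid_TAP_def)

lemma arr_mono: "i \<le> j \<Longrightarrow> j < length T \<Longrightarrow> arr (T ! i) \<le> arr (T ! j)"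
  using sorted_nth_mono[OF sorted_arr, of i j] by simp

lemma
  assumes "k < length T"
  shows ser_pos: "0 < ser (T ! k)"
    and ser_le_par: "ser (T ! k) \<le> par (T ! k)"
    and par_le: "par (T ! k) \<le> real p * ser (T ! k)"
    and arr_nonneg: "0 \<le> arr (T ! k)"
  using valid_TAP assms
  by (auto simp: valid_TAP_def valid_task_def divide_simps dest!: nth_mem split: if_splits)

lemma load_pos: "k < length T \<Longrightarrow> 0 < load p T k"
  using ser_pos ser_le_par by (fastforce simp: load.simps)

lemma load_div_pos: "k < length T \<Longrightarrow> 0 < load p T k / real p"
  using load_pos p_pos by simp

lemma finish_gt_arr: "k < length T \<Longrightarrow> arr (T ! k) < finish p T (Suc k)"
  using load_div_pos[of k] by (simp add: max_def)

lemma finish_mono: "i \<le> j \<Longrightarrow> j \<le> length T \<Longrightarrow> finish p T i \<le> finish p T j"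
proof (induction j rule: dec_induct)
  case (step j)
  then show ?case using load_div_pos[of j] by simp
qed simp

lemma backlog_Suc:
  assumes "k < length T" "s \<le> arr (T ! k)"
  shows "backlog p T k s + load p T k / real p \<le> backlog p T (Suc k) s"
  using assms load_div_pos[of k] by (simp add: backlog_def)

lemma backlog_Suc_arr:
  assumes "k < length T"
  shows "backlog p T (Suc k) (arr (T ! k)) = backlog p T k (arr (T ! k)) + load p T k / real p"
  using load_div_pos[OF assms] by (simp add: backlog_def)

lemma backlog_Suc_arr_pos: "k < length T \<Longrightarrow> 0 < backlog p T (Suc k) (arr (T ! k))"
  using load_div_pos[of k] backlog_nonneg[of p T k "arr (T ! k)"] by (simp add: backlog_Suc_arr)

lemma backlog_add_sum_load_le:
  assumes "j \<le> m" "m \<le> length T"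
  shows "backlog p T j (arr (T ! j)) + (\<Sum>k=j..<m. load p T k) / real p
    \<le> backlog p T m (arr (T ! j))"
  using assms
proof (induction m rule: dec_induct)
  case (step m)
  then show ?case
    using backlog_Suc[of m "arr (T ! j)"] arr_mono[of j m] by (simp add: add_divide_distrib)
qed simp

lemma rate_mult_backlog:
  assumes "k < length T"
  shows "rate p T (Suc k) i * backlog p T (Suc k) (arr (T ! k)) =
    (if i = k then load p T k else rate p T k i * backlog p T k (arr (T ! k)))"
  using backlog_Suc_arr_pos[OF assms] by simp

lemma rate_nonneg: "k \<le> length T \<Longrightarrow> 0 \<le> rate p T k i"
proof (induction k)
  case (Suc k)
  then show ?case
    using load_pos[of k] by (simp add: backlog_nonneg)
qed simp

lemma sum_rate:
  assumes "0 < k" "k \<le> length T"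
  shows "(\<Sum>i<k. rate p T k i) = real p"
  using assms
proof (induction k)
  case (Suc k)
  let ?b = "\<lambda>k'. backlog p T k' (arr (T ! k))"
  have "(\<Sum>i<k. rate p T k i) * ?b k = real p * ?b k"
    using Suc arr_nonneg[of k] by (cases "k = 0") (auto simp: backlog_def Suc_le_eq)
  moreover have "(\<Sum>i<Suc k. rate p T (Suc k) i) * ?b (Suc k)
      = (\<Sum>i<k. rate p T k i) * ?b k + load p T k"
    using Suc.prems by (simp add: distrib_right sum_distrib_right rate_mult_backlog del: rate.simps)
  ultimately have "(\<Sum>i<Suc k. rate p T (Suc k) i) * ?b (Suc k) = real p * ?b (Suc k)"
    using Suc.prems p_pos by (simp add: backlog_Suc_arr distrib_left)
  then show ?case
    using backlog_Suc_arr_pos[of k] Suc.prems by (simp del: rate.simps)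
qed simp

lemma rate_serial_le_1:
  assumes "\<not> goes_parallel p T i" "k \<le> length T"
  shows "rate p T k i \<le> 1"
  using assms(2)
proof (induction k)
  case (Suc k)
  let ?b = "\<lambda>k'. backlog p T k' (arr (T ! k))"
  have "load p T k \<le> ?b k" if "i = k"
    using that assms(1) by (simp add: load.simps goes_parallel.simps backlog_def)
  moreover have "rate p T k i * ?b k \<le> ?b k"
    using Suc backlog_nonneg[of p T k] by (simp add: mult_left_le_one_le rate_nonneg)
  ultimately have "rate p T (Suc k) i * ?b (Suc k) \<le> ?b k"
    using Suc.prems by (simp add: rate_mult_backlog del: rate.simps)
  also have "\<dots> \<le> 1 * ?b (Suc k)"
    using Suc.prems load_div_pos[of k] by (simp add: backlog_Suc_arr)
  finally show ?case
    using backlog_Suc_arr_pos[of k] Suc.prems by (simp del: rate.simps)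
qed simp

lemma plan_from_last_arrival:
  assumes "k < length T" "arr (T ! k) \<le> s"
  shows "plan p T k i s = (if s < finish p T k then rate p T k i else 0)"
proof (cases k)
  case (Suc k')
  then show ?thesis using assms arr_mono[of k' k] by auto
qed simp

lemma plan_nonneg: "k \<le> length T \<Longrightarrow> 0 \<le> plan p T k i s"
  by (induction k) (use rate_nonneg in \<open>auto simp del: rate.simps\<close>)

lemma plan_serial_le_1: "\<not> goes_parallel p T i \<Longrightarrow> k \<le> length T \<Longrightarrow> plan p T k i s \<le> 1"
  by (induction k) (use rate_serial_le_1 in \<open>auto simp del: rate.simps\<close>)

lemma sum_plan_le: "k \<le> length T \<Longrightarrow> (\<Sum>i<k. plan p T k i s) \<le> real p"
proof (induction k)
  case (Suc k)
  then show ?case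
    using sum_rate[of "Suc k"] by (cases "s < arr (T ! k)") (simp_all add: plan_eq_0 del: rate.simps)
qed simp

lemma plan_eq_0_before_arrival:
  assumes "s < arr (T ! i)" "k \<le> length T"
  shows "plan p T k i s = 0"
proof (cases "k \<le> i")
  case False
  then have "plan p T k i s = plan p T i i s"
    using assms by (intro plan_eq_earlier) (auto intro: less_le_trans arr_mono)
  then show ?thesis by (simp add: plan_eq_0)
qed (rule plan_eq_0)

lemma plan_eq_0_after_finish:
  assumes "finish p T k \<le> s" "k \<le> length T"
  shows "plan p T k i s = 0"
proof (cases k)
  case (Suc k')
  then show ?thesis using assms finish_gt_arr[of k'] by simp
qed simp

lemma has_integral_plan:
  assumes "k \<le> length T"
  shows "has_bochner_integral lborel (plan p T k i) (if i < k then load p T i else 0)"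
  using assms
proof (induction k)
  case 0
  have "plan p T 0 i = (\<lambda>s. 0)" by auto
  then show ?case by (simp add: has_bochner_integral_zero)
next
  case (Suc k)
  let ?a = "arr (T ! k)"
  have indicator: "has_bochner_integral lborel (indicator {?a..<finish p T j}) (backlog p T j ?a)" for j
    using has_bochner_integral_real_indicator[of "{?a..<finish p T j}" lborel]
      fmeasurableD2[OF fmeasurable_Ico]
    by (auto simp: backlog_def max_def less_top split: if_splits)
  have plan: "plan p T (Suc k) i = (\<lambda>s. plan p T k i s
      + rate p T (Suc k) i * indicator {?a..<finish p T (Suc k)} s
      - rate p T k i * indicator {?a..<finish p T k} s)"
    using plan_from_last_arrival[of k _ i] Suc.prems
    by (intro ext) (auto simp: indicator_def simp del: rate.simps finish.simps)
  have "has_bochner_integral lborel (plan p T (Suc k) i)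
      ((if i < k then load p T i else 0) + rate p T (Suc k) i * backlog p T (Suc k) ?a
        - rate p T k i * backlog p T k ?a)"
    unfolding plan using Suc
    by (intro has_bochner_integral_diff has_bochner_integral_add has_bochner_integral_mult_right
        indicator) auto
  also have "(if i < k then load p T i else 0) + rate p T (Suc k) i * backlog p T (Suc k) ?a
        - rate p T k i * backlog p T k ?a = (if i < Suc k then load p T i else 0)"
    using Suc.prems rate_eq_0[of k i p T]
    by (cases i k rule: linorder_cases) (simp_all add: rate_mult_backlog del: rate.simps)
  finally show ?case .
qed

lemma processed_balanced_sched:
  assumes i: "i < length T" and c: "arr (T ! i) \<le> c" "finish p T (length (arrived_by T c)) \<le> c"
  shows "processed T (balanced_sched p T) i c = load p T i"
proof -
  let ?m = "length (arrived_by T c)"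
  have "indicator {arr (T ! i)..c} s *\<^sub>R plan p T (length T) i s = plan p T ?m i s" for s
  proof (cases "s \<in> {arr (T ! i)..c}")
    case True
    then show ?thesis using plan_arrived_by[OF sorted_arr, of s c] by simp
  next
    case False
    then have "s < arr (T ! i) \<or> finish p T ?m \<le> s" using c by auto
    then show ?thesis
      using False plan_eq_0_before_arrival plan_eq_0_after_finish length_arrived_by_le by auto
  qed
  then show ?thesis
    using has_integral_plan[OF length_arrived_by_le, of c i]
      less_length_arrived_by_iff[OF sorted_arr i] c(1)
    by (simp add: processed_def balanced_sched_def set_lebesgue_integral_def
        has_bochner_integral_integral_eq)
qed

lemma valid_balanced_sched: "valid_sched p T (balanced_sched p T)"
proof -
  have "\<exists>c\<ge>arr (T ! i). work T (balanced_sched p T) i \<le> processed T (balanced_sched p T) i c"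
    if "i < length T" for i
  proof (intro exI conjI)
    let ?c = "max (arr (T ! i)) (finish p T (length T))"
    show "work T (balanced_sched p T) i \<le> processed T (balanced_sched p T) i ?c"
      using that finish_mono[OF length_arrived_by_le order_refl, of ?c]
      by (simp add: work_balanced_sched processed_balanced_sched)
  qed simp
  moreover have "plan p T (length T) i \<in> borel_measurable lborel" for i
    using has_integral_plan[of "length T" i] borel_measurable_has_bochner_integral by blast
  ultimately show ?thesis
    unfolding valid_sched_def
    by (auto simp: balanced_sched_def plan_nonneg plan_eq_0_before_arrival plan_serial_le_1 sum_plan_le)
qed

lemma awake_set_balanced_sched_subset:
  "awake_set T (balanced_sched p T)
    \<subseteq> (\<Union>k<length T. {max (finish p T k) (arr (T ! k))..<finish p T (Suc k)})"
proof
  fix s assume "s \<in> awake_set T (balanced_sched p T)"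
  then obtain i where i: "i < length T"
    and alive: "arr (T ! i) \<le> s" "s < completion T (balanced_sched p T) i"
    by (auto simp: awake_set_def)
  let ?m = "length (arrived_by T s)"
  have "\<not> finish p T ?m \<le> s"
  proof
    assume "finish p T ?m \<le> s"
    then have "completion T (balanced_sched p T) i \<le> s"
      using i alive(1)
        by (intro completion_le) (simp_all add: work_balanced_sched processed_balanced_sched)
    then show False using alive(2) by simp
  qed
  moreover have "0 \<le> s" using arr_nonneg[OF i] alive(1) by simp
  ultimately obtain k where "k < ?m" "finish p T k \<le> s" "s < finish p T (Suc k)"
    using ex_least_nat_less[of "\<lambda>k. s < finish p T k" ?m] by force
  moreover from this have "k < length T" "arr (T ! k) \<le> s"
    using length_arrived_by_le[of T s] less_length_arrived_by_iff[OF sorted_arr, of k s] by auto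
  ultimately show "s \<in> (\<Union>k<length T. {max (finish p T k) (arr (T ! k))..<finish p T (Suc k)})"
    by auto
qed

lemma awake_balanced_sched_le:
  "awake T (balanced_sched p T) \<le> (\<Sum>k<length T. load p T k) / real p"
proof -
  let ?I = "\<lambda>k. {max (finish p T k) (arr (T ! k))..<finish p T (Suc k)}"
  have "awake T (balanced_sched p T) \<le> measure lborel (\<Union>k<length T. ?I k)"
    unfolding awake_eq_measure_awake_set using awake_set_balanced_sched_subset
    by (intro measure_mono_fmeasurable fmeasurable.finite_UN) auto
  also have "\<dots> \<le> (\<Sum>k<length T. measure lborel (?I k))"
    by (intro measure_UNION_le) auto
  also have "\<dots> = (\<Sum>k<length T. load p T k / real p)"
    using load_div_pos by (intro sum.cong) (auto simp: less_imp_le)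
  finally show ?thesis by (simp add: sum_divide_distrib)
qed

end

section \<open>Comparison with an arbitrary schedule\<close>

text \<open>The time that the scheduler, given the first \<open>m\<close> tasks only, is awake before \<open>b\<close>.\<close>

definition busy_before :: "nat \<Rightarrow> task list \<Rightarrow> nat \<Rightarrow> real \<Rightarrow> real" where
  "busy_before p T m b = (\<Sum>k<m. load p T k) / real p - backlog p T m b"

context tap
begin

lemma sum_load_split:
  assumes "j \<le> m"
  shows "(\<Sum>k<m. load p T k) / real p =
    (\<Sum>k<j. load p T k) / real p + (\<Sum>k=j..<m. load p T k) / real p"
  using assms
  by (simp add: add_divide_distrib[symmetric] lessThan_atLeast0 sum.atLeastLessThan_concat)

lemma busy_before_le_add_elapsed:
  assumes "j \<le> m" "m \<le> length T" "arr (T ! j) \<le> b"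
  shows "busy_before p T m b \<le> busy_before p T j (arr (T ! j)) + (b - arr (T ! j))"
proof -
  have "backlog p T m (arr (T ! j)) \<le> backlog p T m b + (b - arr (T ! j))"
    using assms(3) by (simp add: backlog_def)
  then show ?thesis
    using sum_load_split[OF assms(1)] backlog_add_sum_load_le[OF assms(1,2)]
    by (simp add: busy_before_def)
qed

lemma busy_before_le_after_parallel:
  assumes "i < m" "m \<le> length T" "goes_parallel p T i"
  shows "busy_before p T m b
    \<le> busy_before p T i (arr (T ! i)) + 2 * ser (T ! i) + (\<Sum>k=Suc i..<m. load p T k) / real p"
proof -
  have i: "i < length T" using assms by simp
  have "backlog p T i (arr (T ! i)) \<le> ser (T ! i)"
    using assms(3) ser_pos[OF i] by (simp add: goes_parallel.simps backlog_def)
  moreover have "load p T i / real p \<le> ser (T ! i)"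
    using assms(3) par_le[OF i] p_pos by (simp add: load.simps field_simps)
  moreover have "(\<Sum>k=i..<m. load p T k) / real p
      = load p T i / real p + (\<Sum>k=Suc i..<m. load p T k) / real p"
    using assms(1) by (simp add: sum.atLeast_Suc_lessThan add_divide_distrib)
  ultimately show ?thesis
    using sum_load_split[of i m] assms(1) backlog_nonneg[of p T m b]
    by (simp add: busy_before_def)
qed

end

lemma obtain_last_less:
  fixes m :: nat
  assumes "\<exists>i<m. P i"
  obtains i where "i < m" "P i" "\<And>k. i < k \<Longrightarrow> k < m \<Longrightarrow> \<not> P k"
proof -
  have "finite {i. i < m \<and> P i}" "{i. i < m \<and> P i} \<noteq> {}" using assms by auto
  then obtain i where "i \<in> {i. i < m \<and> P i}" "\<forall>k\<in>{i. i < m \<and> P i}. k \<le> i"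
    using Max_in Max_ge by blast
  then show thesis by (intro that[of i]) auto
qed

locale tap_comparison = tap p T + valid_schedule p T S for p T S
begin

definition wrongly_parallel :: "nat \<Rightarrow> bool" where
  "wrongly_parallel k \<longleftrightarrow> goes_parallel p T k \<and> \<not> choice S k"

lemma sum_load_le_awake_within:
  assumes K: "K \<subseteq> {..<length T}" "\<And>k. k \<in> K \<Longrightarrow> a \<le> arr (T ! k) \<and> completion T S k \<le> b"
    and "\<And>k. k \<in> K \<Longrightarrow> \<not> wrongly_parallel k"
  shows "(\<Sum>k\<in>K. load p T k) / real p \<le> awake_within T S a b"
proof -
  have "(\<Sum>k\<in>K. load p T k) \<le> (\<Sum>k\<in>K. work T S k)"
    using assms ser_le_par
    by (intro sum_mono) (auto simp: load.simps work_def wrongly_parallel_def)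
  also have "\<dots> \<le> real p * awake_within T S a b"
    using K by (rule sum_work_le_awake_within)
  finally show ?thesis
    using p_pos by (simp add: field_simps)
qed

lemma busy_before_le_last_wrongly_parallel:
  assumes m: "m \<le> length T" "\<And>k. k < m \<Longrightarrow> completion T S k \<le> b"
    and i: "i < m" "wrongly_parallel i" "\<And>k. i < k \<Longrightarrow> k < m \<Longrightarrow> \<not> wrongly_parallel k"
  shows "busy_before p T m b
    \<le> busy_before p T i (arr (T ! i)) + 3 * awake_within T S (arr (T ! i)) b"
proof -
  have "(\<Sum>k=Suc i..<m. load p T k) / real p \<le> awake_within T S (arr (T ! i)) b"
    using m i arr_mono[of i] by (intro sum_load_le_awake_within) auto
  moreover have "ser (T ! i) \<le> awake_within T S (arr (T ! i)) b"
    using m i by (intro ser_le_awake_within) (auto simp: wrongly_parallel_def)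
  ultimately show ?thesis
    using busy_before_le_after_parallel[of i m b] m(1) i(1,2) by (simp add: wrongly_parallel_def)
qed

lemma busy_before_le_never_wrongly_parallel:
  assumes "m \<le> length T" "\<And>k. k < m \<Longrightarrow> completion T S k \<le> b"
    and "\<And>k. k < m \<Longrightarrow> \<not> wrongly_parallel k"
  shows "busy_before p T m b \<le> awake_within T S 0 b"
proof -
  have "(\<Sum>k<m. load p T k) / real p \<le> awake_within T S 0 b"
    using assms arr_nonneg by (intro sum_load_le_awake_within) auto
  then show ?thesis
    using backlog_nonneg[of p T m b] by (simp add: busy_before_def)
qed

lemma busy_before_le_3_awake_within:
  assumes "m \<le> length T" "0 \<le> b" "\<And>k. k < m \<Longrightarrow> arr (T ! k) \<le> b"
  shows "busy_before p T m b \<le> 3 * awake_within T S 0 b"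
  using assms
proof (induction m arbitrary: b rule: less_induct)
  case (less m)
  have until_arrival: "busy_before p T j (arr (T ! j)) \<le> 3 * awake_within T S 0 (arr (T ! j))"
    if "j < m" for j
    using that less.prems arr_nonneg arr_mono by (intro less.IH) auto
  have split: "awake_within T S 0 b
      = awake_within T S 0 (arr (T ! j)) + awake_within T S (arr (T ! j)) b" if "j < m" for j
    using that less.prems arr_nonneg by (intro awake_within_split) auto
  consider (alive) j where "j < m" "b < completion T S j"
    | (wrong) "\<And>k. k < m \<Longrightarrow> completion T S k \<le> b" "\<exists>i<m. wrongly_parallel i"
    | (never_wrong) "\<And>k. k < m \<Longrightarrow> completion T S k \<le> b" "\<And>k. k < m \<Longrightarrow> \<not> wrongly_parallel k"
    by (meson not_le)
  then show ?case
  proof cases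
    case alive
    then have "awake_within T S (arr (T ! j)) b = b - arr (T ! j)"
      using less.prems by (intro awake_within_alive) auto
    moreover have "busy_before p T m b \<le> busy_before p T j (arr (T ! j)) + (b - arr (T ! j))"
      using alive less.prems by (intro busy_before_le_add_elapsed) auto
    ultimately show ?thesis
      using until_arrival[OF alive(1)] split[OF alive(1)] less.prems(3)[OF alive(1)] by simp
  next
    case wrong
    obtain i where i: "i < m" "wrongly_parallel i"
      and last: "\<And>k. i < k \<Longrightarrow> k < m \<Longrightarrow> \<not> wrongly_parallel k"
      by (rule obtain_last_less[OF wrong(2)]) blast
    then show ?thesis
      using busy_before_le_last_wrongly_parallel[OF less.prems(1) wrong(1) i last]
        until_arrival[OF i(1)] split[OF i(1)] by simp
  next
    case never_wrong
    then show ?thesis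
      using busy_before_le_never_wrongly_parallel[of m b] less.prems(1)
        awake_within_nonneg[of T S 0 b] by simp
  qed
qed

lemma awake_balanced_sched_le_3_awake: "awake T (balanced_sched p T) \<le> 3 * awake T S"
proof -
  let ?n = "length T" and ?end = "finish p T (length T)"
  have "0 \<le> ?end" using finish_mono[of 0 ?n] by simp
  moreover have "arr (T ! k) \<le> ?end" if "k < ?n" for k
    using finish_gt_arr[OF that] finish_mono[of "Suc k" ?n] that by simp
  ultimately have "busy_before p T ?n ?end \<le> 3 * awake_within T S 0 ?end"
    by (intro busy_before_le_3_awake_within) auto
  then show ?thesis
    using awake_balanced_sched_le awake_within_le_awake[of T S 0 ?end]
    by (simp add: busy_before_def backlog_def)
qed

end

lemma (in tap) awake_balanced_sched_le_3_OPT: "awake T (balanced_sched p T) \<le> 3 * OPT p T"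
proof -
  have "awake T (balanced_sched p T) \<le> 3 * awake T S" if "valid_sched p T S" for S
  proof -
    interpret tap_comparison p T S using that by unfold_locales
    show ?thesis by (rule awake_balanced_sched_le_3_awake)
  qed
  then have "awake T (balanced_sched p T) / 3 \<le> OPT p T"
    unfolding OPT_def using valid_balanced_sched by (intro cInf_greatest) (auto simp: field_simps)
  then show ?thesis by simp
qed

theorem theorem4p2:
  shows "\<exists>p0::nat. \<forall>p \<ge> p0. \<exists>A :: task list \<Rightarrow> sched.
           online p A \<and> decide_on_arrival p A \<and>
           (\<forall>T. valid_TAP p T \<longrightarrow> valid_sched p T (A T) \<and> awake T (A T) \<le> 3 * OPT p T)"
proof (intro exI[of _ 1] allI impI)
  fix p :: nat
  assume "1 \<le> p"
  then have tap: "tap p T" if "valid_TAP p T" for T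
    using that by unfold_locales auto
  show "\<exists>A. online p A \<and> decide_on_arrival p A \<and>
      (\<forall>T. valid_TAP p T \<longrightarrow> valid_sched p T (A T) \<and> awake T (A T) \<le> 3 * OPT p T)"
    using online_balanced_sched decide_on_arrival_balanced_sched
      tap.valid_balanced_sched[OF tap] tap.awake_balanced_sched_le_3_OPT[OF tap]
    by (intro exI[of _ "balanced_sched p"]) blast
qed

end
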